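(* Let $G$ be a connected graph and let $a$ be any vertex of $G$. Then there exists a minimal dominating set of $G$ containing $a$.
   Context: Graphs are finite, simple and undirected, with nonempty vertex set. A dominating set of a graph $G$ with vertex set $V(G)$ is a set $D\subseteq V(G)$ such that every vertex in $V(G)\setminus D$ is adjacent to some vertex of $D$. A dominating set is minimal if it does not properly contain any other dominating set. *)

theory Defs
  imports "Graph_Theory.Digraph_Component"
begin

text \<open>
  Finite simple undirected graphs are modelled by the locale \<^locale>\<open>graph\<close>, that is, as finite
  symmetric digraphs without loops and parallel arcs, an edge being a pair of opposite arcs.
  For these, \<open>u \<rightarrow>\<^bsub>G\<^esub> v\<close> is the (symmetric) adjacency relation.  The locale admits the null
  graph, but the library's \<^const>\<open>connected\<close> requires a nonempty vertex set.
\<close>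

definition dominating_set :: "('a, 'b) pre_digraph \<Rightarrow> 'a set \<Rightarrow> bool" where
  "dominating_set G D \<longleftrightarrow>
     D \<subseteq> verts G \<and> (\<forall>v \<in> verts G - D. \<exists>u \<in> D. v \<rightarrow>\<^bsub>G\<^esub> u)"

definition minimal_dominating_set :: "('a, 'b) pre_digraph \<Rightarrow> 'a set \<Rightarrow> bool" where
  "minimal_dominating_set G D \<longleftrightarrow>
     dominating_set G D \<and> \<not> (\<exists>D'. dominating_set G D' \<and> D' \<subset> D)"

end

theory Submission
  imports Defs
begin

text \<open>
  The non-neighbours of \<open>a\<close>, with \<open>a\<close> among them since there are no loops, form a dominating set:
  every other vertex is a neighbour of \<open>a\<close>. By finiteness it contains a minimal dominating set
  \<open>D\<close>. No element of \<open>D\<close> is adjacent to \<open>a\<close>, so the only way for \<open>D\<close> to dominate \<open>a\<close> is to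
  contain it.
\<close>

lemma dominating_set_contains_minimal:
  assumes "finite (verts G)" and "dominating_set G D"
  obtains D' where "D' \<subseteq> D" and "minimal_dominating_set G D'"
proof -
  have "{X. dominating_set G X} \<subseteq> Pow (verts G)"
    by (auto simp: dominating_set_def)
  then have "finite {X. dominating_set G X}"
    using assms(1) by (meson finite_Pow_iff finite_subset)
  moreover have "D \<in> {X. dominating_set G X}"
    using assms(2) by simp
  ultimately obtain D' where D': "D' \<in> {X. dominating_set G X}" "D' \<subseteq> D"
    and min: "\<forall>X \<in> {X. dominating_set G X}. X \<subseteq> D' \<longrightarrow> D' = X"
    using finite_has_minimal2[of "{X. dominating_set G X}" D] by blast
  then have "minimal_dominating_set G D'"
    unfolding minimal_dominating_set_def by blast
  with D'(2) show thesis
    by (rule that)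
qed

theorem theorem3p1:
  fixes G :: "('a, 'b) pre_digraph" and a :: 'a
  assumes "graph G" and "connected G" and "a \<in> verts G"
  shows "\<exists>D. minimal_dominating_set G D \<and> a \<in> D"
proof -
  interpret graph G by (rule assms(1))
  let ?N = "{v. v \<rightarrow>\<^bsub>G\<^esub> a}"
  have "a \<notin> ?N"
    using adj_not_same by blast
  then have "a \<in> verts G - ?N"
    using assms(3) by blast
  then have "dominating_set G (verts G - ?N)"
    unfolding dominating_set_def by blast
  then obtain D where D: "D \<subseteq> verts G - ?N" "minimal_dominating_set G D"
    by (rule dominating_set_contains_minimal[OF finite_verts])
  have "a \<in> D"
  proof (rule ccontr)
    assume "a \<notin> D"
    then obtain u where "u \<in> D" "a \<rightarrow>\<^bsub>G\<^esub> u"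
      using D(2) assms(3) unfolding minimal_dominating_set_def dominating_set_def by blast
    then have "u \<in> ?N"
      using arcs_ends_symmetric[OF sym_arcs] by blast
    then show False
      using \<open>u \<in> D\<close> D(1) by blast
  qed
  then show ?thesis
    using D(2) by blast
qed

end
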